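(* Let $n$ be a positive integer (the number of trials), let $\psi\in[0,1]$ and $\omega>0$, and let $Y_n\sim (L)MBD(\psi,\omega)$ with $n$ trials. Let $\pi=\psi\tau_1(\psi,\omega)$ be the success probability of a single trial, and suppose that $\psi=\pi/\tau_1\ge\frac12$. Then $$\omega>1\ \Longrightarrow\ \psi>\pi.$$
   Context: For an integer $n\ge 1$, $\psi\in[0,1]$ and $\omega>0$, the (Lovison's) Multiplicative Binomial Distribution $(L)MBD(\psi,\omega)$ with $n$ trials is the probability distribution on $\{0,1,\dots,n\}$ given by $$P(Y_n=y)=\frac{\binom{n}{y}\psi^y(1-\psi)^{n-y}\omega^{(n-y)y}}{\sum_{i=0}^{n}\binom{n}{i}\psi^i(1-\psi)^{n-i}\omega^{(n-i)i}},\qquad y=0,1,\dots,n,$$ with the convention $0^0=1$. It is the law of $Y_n=\sum_{i=1}^n Z_i$ for exchangeable $\{0,1\}$-valued random variables $Z_1,\dots,Z_n$, and $\pi=P(Z_i=1)=E[Y_n]/n$ is the common success probability of a single trial. Put $$\tau_1=\tau_1(\psi,\omega)=\frac{K_{n-1}(\psi,\omega)}{K_n(\psi,\omega)},$$ where $$K_{n-1}(\psi,\omega)=\sum_{i=0}^{n-1}\binom{n-1}{i}\psi^i(1-\psi)^{n-1-i}\omega^{(n-1-i)(i+1)},\qquad K_n(\psi,\omega)=\sum_{i=0}^{n}\binom{n}{i}\psi^i(1-\psi)^{n-i}\omega^{(n-i)i}.$$ Then $E[Y_n]=n\psi\tau_1$, so that $\pi=\psi\tau_1$.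
   Formalization: The cases n = 1, ψ = 1/2 and ψ = 1 are excluded: in each of them π = ψ for every ω > 0, so the strict inequality ψ > π fails; the claim is proved for all n ≥ 2 and 1/2 < ψ < 1. *)

theory Defs
  imports "HOL-Probability.Probability"
begin

text \<open>
  Lovison's multiplicative binomial distribution with \<open>n\<close> trials and parameters
  \<open>\<psi> \<in> [0,1]\<close>, \<open>\<omega> > 0\<close>. All exponents are natural numbers, so \<open>0 ^ 0 = 1\<close>; the
  truncated subtractions are exact on the ranges of summation.
\<close>

definition lmbd_weight :: "nat \<Rightarrow> real \<Rightarrow> real \<Rightarrow> nat \<Rightarrow> real" where
  "lmbd_weight n \<psi> \<omega> y = real (n choose y) * \<psi> ^ y * (1 - \<psi>) ^ (n - y) * \<omega> ^ ((n - y) * y)"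

definition lmbd_K :: "nat \<Rightarrow> real \<Rightarrow> real \<Rightarrow> real" where
  "lmbd_K n \<psi> \<omega> = (\<Sum>i=0..n. real (n choose i) * \<psi> ^ i * (1 - \<psi>) ^ (n - i) * \<omega> ^ ((n - i) * i))"

text \<open>
  The quantity written $K_{n-1}$ is not the instance of $K_n$ at \<open>n - 1\<close>: the exponent
  of \<open>\<omega>\<close> is \<open>(n - 1 - i) * (i + 1)\<close>. The argument below is the number of trials \<open>n \<ge> 1\<close>.
\<close>

definition lmbd_K_pred :: "nat \<Rightarrow> real \<Rightarrow> real \<Rightarrow> real" where
  "lmbd_K_pred n \<psi> \<omega> = (\<Sum>i=0..n - 1. real ((n - 1) choose i) * \<psi> ^ i * (1 - \<psi>) ^ (n - 1 - i)
       * \<omega> ^ ((n - 1 - i) * (i + 1)))"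

definition lmbd_tau1 :: "nat \<Rightarrow> real \<Rightarrow> real \<Rightarrow> real" where
  "lmbd_tau1 n \<psi> \<omega> = lmbd_K_pred n \<psi> \<omega> / lmbd_K n \<psi> \<omega>"

definition lmbd_pmf :: "nat \<Rightarrow> real \<Rightarrow> real \<Rightarrow> nat pmf" where
  "lmbd_pmf n \<psi> \<omega> = embed_pmf (\<lambda>y. if y \<le> n then lmbd_weight n \<psi> \<omega> y / lmbd_K n \<psi> \<omega> else 0)"

lemma lmbd_weight_nonneg:
  assumes "\<psi> \<in> {0..1}" "\<omega> > 0"
  shows "0 \<le> lmbd_weight n \<psi> \<omega> y"
  using assms by (simp add: lmbd_weight_def)

lemma lmbd_K_eq_sum_weight: "lmbd_K n \<psi> \<omega> = (\<Sum>y\<le>n. lmbd_weight n \<psi> \<omega> y)"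
  by (simp add: lmbd_K_def lmbd_weight_def atLeast0AtMost)

lemma lmbd_K_pos:
  assumes "\<psi> \<in> {0..1}" "\<omega> > 0"
  shows "0 < lmbd_K n \<psi> \<omega>"
proof -
  define y where "y = (if \<psi> = 0 then 0 else n)"
  have "0 < lmbd_weight n \<psi> \<omega> y"
    using assms by (auto simp: lmbd_weight_def y_def)
  moreover have "lmbd_weight n \<psi> \<omega> y \<le> (\<Sum>y\<le>n. lmbd_weight n \<psi> \<omega> y)"
    using lmbd_weight_nonneg[OF assms] by (intro member_le_sum) (auto simp: y_def)
  ultimately show ?thesis
    by (simp add: lmbd_K_eq_sum_weight)
qed

text \<open>The arguments of \<^const>\<open>embed_pmf\<close> do form a probability mass function.\<close>

lemma pmf_lmbd:
  assumes "\<psi> \<in> {0..1}" "\<omega> > 0"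
  shows "pmf (lmbd_pmf n \<psi> \<omega>) y =
    (if y \<le> n then lmbd_weight n \<psi> \<omega> y / lmbd_K n \<psi> \<omega> else 0)"
  unfolding lmbd_pmf_def
proof (rule pmf_embed_pmf)
  let ?f = "\<lambda>y. if y \<le> n then lmbd_weight n \<psi> \<omega> y / lmbd_K n \<psi> \<omega> else 0"
  show nn: "0 \<le> ?f y" for y
    using lmbd_weight_nonneg[OF assms] lmbd_K_pos[OF assms] by (simp add: less_imp_le)
  have "(\<integral>\<^sup>+ y. ennreal (?f y) \<partial>count_space UNIV) = (\<integral>\<^sup>+ y. ennreal (?f y) \<partial>count_space {..n})"
    by (subst nn_integral_count_space_indicator) (auto intro!: nn_integral_cong split: split_indicator)
  also have "\<dots> = (\<Sum>y\<le>n. ennreal (?f y))"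
    by (simp add: nn_integral_count_space_finite)
  also have "\<dots> = ennreal (\<Sum>y\<le>n. ?f y)"
    using nn by (rule sum_ennreal)
  also have "(\<Sum>y\<le>n. ?f y) = 1"
    using lmbd_K_pos[OF assms, of n] 
    by (simp add: lmbd_K_eq_sum_weight flip: sum_divide_distrib)
  finally show "(\<integral>\<^sup>+ y. ennreal (?f y) \<partial>count_space UNIV) = 1"
    by simp
qed

lemma expectation_lmbd:
  assumes "1 \<le> n" "\<psi> \<in> {0..1}" "\<omega> > 0"
  shows "measure_pmf.expectation (lmbd_pmf n \<psi> \<omega>) real = real n * (\<psi> * lmbd_tau1 n \<psi> \<omega>)"
proof -
  obtain m where n: "n = Suc m"
    using assms(1) by (cases n) auto
  have step: "lmbd_weight n \<psi> \<omega> (Suc i) * real (Suc i) = real n * \<psi> *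
      (real (m choose i) * \<psi> ^ i * (1 - \<psi>) ^ (m - i) * \<omega> ^ ((m - i) * (i + 1)))" for i
  proof -
    have "real (n choose Suc i) * real (Suc i) = real n * real (m choose i)"
      unfolding n using Suc_times_binomial[of i m]
      by (metis mult.commute of_nat_mult)
    then show ?thesis
      by (simp add: lmbd_weight_def n mult_ac)
  qed
  have "measure_pmf.expectation (lmbd_pmf n \<psi> \<omega>) real
      = (\<Sum>y\<le>n. real y * pmf (lmbd_pmf n \<psi> \<omega>) y)"
    by (rule integral_measure_pmf_real)
      (auto simp: set_pmf_eq pmf_lmbd[OF assms(2,3)] split: if_splits)
  also have "\<dots> = (\<Sum>y\<le>n. lmbd_weight n \<psi> \<omega> y * real y) / lmbd_K n \<psi> \<omega>"
    by (simp add: pmf_lmbd[OF assms(2,3)] sum_divide_distrib mult.commute)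
  also have "(\<Sum>y\<le>n. lmbd_weight n \<psi> \<omega> y * real y)
      = (\<Sum>i\<le>m. lmbd_weight n \<psi> \<omega> (Suc i) * real (Suc i))"
    unfolding n by (subst sum.atMost_Suc_shift) simp
  also have "\<dots> = real n * \<psi> * lmbd_K_pred n \<psi> \<omega>"
    by (simp only: step lmbd_K_pred_def sum_distrib_left) (simp add: n atLeast0AtMost)
  finally show ?thesis
    by (simp add: lmbd_tau1_def)
qed

text \<open>
  Hence \<open>\<psi> * lmbd_tau1 n \<psi> \<omega>\<close> is the common success probability of \<open>{0,1}\<close>-valued trials
  whose sum has the distribution \<^const>\<open>lmbd_pmf\<close>.
\<close>

lemma lmbd_success_prob:
  fixes Z :: "nat \<Rightarrow> 'a \<Rightarrow> nat"
  assumes "prob_space M" "1 \<le> n" "\<psi> \<in> {0..1}" "\<omega> > 0"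
    and Z: "\<And>i. i < n \<Longrightarrow> Z i \<in> measurable M (count_space UNIV)"
    and Z01: "\<And>i x. i < n \<Longrightarrow> x \<in> space M \<Longrightarrow> Z i x \<in> {0, 1}"
    and p: "\<And>i. i < n \<Longrightarrow> measure M {x \<in> space M. Z i x = 1} = p"
    and law: "distr M (count_space UNIV) (\<lambda>x. \<Sum>i<n. Z i x) = measure_pmf (lmbd_pmf n \<psi> \<omega>)"
  shows "p = \<psi> * lmbd_tau1 n \<psi> \<omega>"
proof -
  interpret prob_space M by fact
  have ev: "{x \<in> space M. Z i x = 1} \<in> sets M" if "i < n" for i
    using measurable_sets[OF Z[OF that], of "{1}"]
    by (simp add: vimage_def Int_def conj_commute)
  have Y: "(\<lambda>x. \<Sum>i<n. Z i x) \<in> measurable M (count_space UNIV)"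
    by (intro measurable_sum_nat Z) auto
  have "real n * (\<psi> * lmbd_tau1 n \<psi> \<omega>)
      = (LINT y|distr M (count_space UNIV) (\<lambda>x. \<Sum>i<n. Z i x). real y)"
    by (simp only: law expectation_lmbd[OF assms(2-4)])
  also have "\<dots> = (LINT x|M. real (\<Sum>i<n. Z i x))"
    by (rule integral_distr[OF Y]) simp
  also have "\<dots> = (LINT x|M. (\<Sum>i<n. indicator {x \<in> space M. Z i x = 1} x))"
  proof (intro Bochner_Integration.integral_cong refl)
    fix x assume x: "x \<in> space M"
    have "real (Z i x) = indicator {x \<in> space M. Z i x = 1} x" if "i < n" for i
      using Z01[OF that x] x by (auto simp: indicator_def)
    then show "real (\<Sum>i<n. Z i x) = (\<Sum>i<n. indicator {x \<in> space M. Z i x = 1} x)"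
      by (simp only: of_nat_sum) (rule sum.cong, auto)
  qed
  also have "\<dots> = (\<Sum>i<n. (LINT x|M. indicator {x \<in> space M. Z i x = 1} x))"
    by (intro Bochner_Integration.integral_sum) (use ev in \<open>auto simp: emeasure_eq_measure\<close>)
  also have "\<dots> = (\<Sum>i<n. p)"
    using ev p by (intro sum.cong) auto
  finally show ?thesis
    using assms(2) by simp
qed

text \<open>
  Degenerate cases, for every \<open>\<omega> > 0\<close>: if \<open>n = 1\<close>, \<open>\<psi> = 1/2\<close> or \<open>\<psi> = 1\<close>, then
  \<open>\<psi> * lmbd_tau1 n \<psi> \<omega> = \<psi>\<close>, so a strict inequality between \<open>\<psi>\<close> and the success
  probability can only hold outside these cases.
\<close>

lemma lmbd_success_prob_degenerate:
  assumes "1 \<le> n" "\<omega> > 0" "n = 1 \<or> \<psi> = 1/2 \<or> \<psi> = 1"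
  shows "\<psi> * lmbd_tau1 n \<psi> \<omega> = \<psi>"
  using assms(3)
proof (elim disjE)
  assume "n = 1"
  then show ?thesis
    by (simp add: lmbd_tau1_def lmbd_K_pred_def lmbd_K_def)
next
  assume "\<psi> = 1"
  have "lmbd_K n 1 \<omega> = (\<Sum>i=0..n. if i = n then 1 else 0)"
    unfolding lmbd_K_def by (intro sum.cong) auto
  moreover have "lmbd_K_pred n 1 \<omega> = (\<Sum>i=0..n-1. if i = n-1 then 1 else 0)"
    unfolding lmbd_K_pred_def by (intro sum.cong) auto
  ultimately show ?thesis
    using \<open>\<psi> = 1\<close> by (simp add: lmbd_tau1_def)
next
  assume half: "\<psi> = 1/2"
  have r: "\<psi> \<in> {0..1}" using half by simp
  let ?w = "lmbd_weight n \<psi> \<omega>"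
  have sym: "?w (n - y) = ?w y" if "y \<le> n" for y
    using that by (simp add: lmbd_weight_def half binomial_symmetric[of y n] mult_ac)
  have "(\<Sum>y\<le>n. ?w y * real y) = (\<Sum>y\<le>n. ?w (n - y) * real (n - y))"
    by (rule sum.reindex_bij_witness[of _ "\<lambda>y. n - y" "\<lambda>y. n - y"]) auto
  also have "\<dots> = (\<Sum>y\<le>n. ?w y * (real n - real y))"
    by (intro sum.cong) (auto simp: sym of_nat_diff)
  also have "\<dots> = real n * lmbd_K n \<psi> \<omega> - (\<Sum>y\<le>n. ?w y * real y)"
    by (simp add: lmbd_K_eq_sum_weight right_diff_distrib sum_subtractf sum_distrib_left mult.commute)
  finally have e: "(\<Sum>y\<le>n. ?w y * real y) = real n * lmbd_K n \<psi> \<omega> / 2"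
    by simp
  have "real n * (\<psi> * lmbd_tau1 n \<psi> \<omega>) = (\<Sum>y\<le>n. real y * pmf (lmbd_pmf n \<psi> \<omega>) y)"
    unfolding expectation_lmbd[OF assms(1) r assms(2), symmetric]
    by (rule integral_measure_pmf_real)
      (auto simp: set_pmf_eq pmf_lmbd[OF r assms(2)] split: if_splits)
  also have "\<dots> = (\<Sum>y\<le>n. ?w y * real y) / lmbd_K n \<psi> \<omega>"
    by (simp add: pmf_lmbd[OF r assms(2)] sum_divide_distrib mult.commute)
  also have "\<dots> = real n / 2"
    using lmbd_K_pos[OF r assms(2), of n] by (simp add: e)
  finally show ?thesis
    using assms(1) by (simp add: half)
qed

end

theory Submission
  imports Defs
begin

text \<open>
  Write \<open>g y = \<omega> ^ ((n - y) * y)\<close> and \<open>m = n - 1\<close>. Pascal's rule gives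
  \<open>K_pred - K = (1 - \<psi>) * (\<Sum>j\<le>m. b j * (g (j + 1) - g j))\<close> with \<open>b\<close> the binomial weights of \<open>m\<close>
  trials. As \<open>g\<close> is symmetric about \<open>n / 2\<close>, its increments are antisymmetric under
  \<open>j \<mapsto> m - j\<close>, so twice this sum is \<open>\<Sum>j\<le>m. (b j - b (m - j)) * (g (j + 1) - g j)\<close>. For
  \<open>\<psi> > 1/2\<close> and \<open>\<omega> > 1\<close> the two factors have opposite signs for every \<open>j\<close>, strictly so for
  \<open>j = 0 < m\<close>. Hence \<open>K_pred < K\<close>, that is, \<open>\<tau>\<^sub>1 < 1\<close>.
\<close>

text \<open>Pascal's rule splits each \<open>Suc m choose i\<close>, and one half is shifted by one
  index. For \<open>p + q = 1\<close> this is conditioning on one of the \<open>Suc m\<close>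
  trials.\<close>

lemma sum_binomial_Suc:
  fixes p q :: "'a::comm_semiring_1"
  shows "(\<Sum>i\<le>Suc m. of_nat (Suc m choose i) * p ^ i * q ^ (Suc m - i) * g i) =
    (\<Sum>j\<le>m. of_nat (m choose j) * p ^ j * q ^ (m - j) * (p * g (Suc j) + q * g j))"
proof -
  let ?b = "\<lambda>j. of_nat (m choose j) * p ^ j * q ^ (m - j)"
  have "(\<Sum>i\<le>Suc m. of_nat (Suc m choose i) * p ^ i * q ^ (Suc m - i) * g i) =
      q ^ Suc m * g 0 + (\<Sum>j\<le>m. of_nat (m choose Suc j) * p ^ Suc j * q ^ (m - j) * g (Suc j))
      + (\<Sum>j\<le>m. ?b j * (p * g (Suc j)))"
    by (subst sum.atMost_Suc_shift) (simp add: sum.distrib algebra_simps)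
  also have "q ^ Suc m * g 0 + (\<Sum>j\<le>m. of_nat (m choose Suc j) * p ^ Suc j * q ^ (m - j) * g (Suc j))
      = (\<Sum>i\<le>Suc m. of_nat (m choose i) * p ^ i * q ^ (Suc m - i) * g i)"
    by (subst sum.atMost_Suc_shift) simp
  \<comment> \<open>The top term drops out because \<open>m choose Suc m\<close> is 0.\<close>
  also have "\<dots> = (\<Sum>j\<le>m. ?b j * (q * g j))"
    by (simp add: binomial_eq_0) (auto simp: Suc_diff_le mult_ac intro!: sum.cong)
  finally show ?thesis
    by (simp add: sum.distrib distrib_left add.commute)
qed

lemma power_mult_power_swap_le:
  fixes a b :: "'a::linordered_semidom"
  assumes "0 \<le> b" "b \<le> a" "j \<le> k"
  shows "a ^ j * b ^ k \<le> a ^ k * b ^ j"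
proof -
  obtain d where k: "k = j + d"
    using assms(3) le_Suc_ex by blast
  have "(a ^ j * b ^ j) * b ^ d \<le> (a ^ j * b ^ j) * a ^ d"
    using assms by (intro mult_left_mono power_mono) auto
  then show ?thesis
    by (simp add: k power_add mult_ac)
qed

text \<open>The exponents \<open>k * Suc j\<close> and \<open>Suc k * j\<close> differ by k - j, so
  the order of j and k fixes the signs of both factors, in opposite directions. It is applied with
  \<open>k = m - j\<close>.\<close>

lemma swapped_increment_nonpos:
  fixes a b \<omega> :: "'a::linordered_idom"
  assumes "0 \<le> b" "b \<le> a" "1 \<le> \<omega>"
  shows "(a ^ j * b ^ k - a ^ k * b ^ j) * (\<omega> ^ (k * Suc j) - \<omega> ^ (Suc k * j)) \<le> 0"
proof (cases "j \<le> k")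
  case True
  then have "\<omega> ^ (Suc k * j) \<le> \<omega> ^ (k * Suc j)"
    using assms by (intro power_increasing) auto
  with power_mult_power_swap_le[OF assms(1,2) True] show ?thesis
    by (simp add: mult_nonpos_nonneg)
next
  case False
  then have kj: "k \<le> j" by simp
  then have "\<omega> ^ (k * Suc j) \<le> \<omega> ^ (Suc k * j)"
    using assms by (intro power_increasing) auto
  with power_mult_power_swap_le[OF assms(1,2) kj] show ?thesis
    by (simp add: mult_nonneg_nonpos)
qed

lemma sum_binomial_increment_neg:
  fixes a b \<omega> :: real
  assumes "0 \<le> b" "b < a" "1 < \<omega>" "0 < m"
  shows "(\<Sum>j\<le>m. real (m choose j) * a ^ j * b ^ (m - j) *
    (\<omega> ^ ((m - j) * Suc j) - \<omega> ^ (Suc (m - j) * j))) < 0" (is "?S < 0")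
proof -
  let ?d = "\<lambda>j. \<omega> ^ ((m - j) * Suc j) - \<omega> ^ (Suc (m - j) * j)"
  let ?t = "\<lambda>j. real (m choose j) * ((a ^ j * b ^ (m - j) - a ^ (m - j) * b ^ j) * ?d j)"
  have "?S = (\<Sum>j\<le>m. real (m choose (m - j)) * a ^ (m - j) * b ^ (m - (m - j)) * ?d (m - j))"
    by (rule sum.reindex_bij_witness[of _ "\<lambda>j. m - j" "\<lambda>j. m - j"]) auto
  \<comment> \<open>Replacing j by \<open>m - j\<close> exchanges the two powers in
    \<open>?d\<close>.\<close>
  also have "\<dots> = (\<Sum>j\<le>m. real (m choose j) * a ^ (m - j) * b ^ j * - ?d j)"
    by (intro sum.cong) (auto simp: binomial_symmetric[symmetric] mult.commute)
  finally have "?S + ?S = ?S + (\<Sum>j\<le>m. real (m choose j) * a ^ (m - j) * b ^ j * - ?d j)"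
    by (rule arg_cong)
  also have "\<dots> = (\<Sum>j\<le>m. ?t j)"
    unfolding sum.distrib[symmetric] by (intro sum.cong refl) (simp only: algebra_simps minus_diff_eq)
  also have "\<dots> < (\<Sum>j\<le>m. 0)"
  proof (rule sum_strict_mono_ex1)
    show "\<forall>j\<in>{..m}. ?t j \<le> 0"
      using assms by (intro ballI mult_nonneg_nonpos swapped_increment_nonpos) auto
    \<comment> \<open>\<open>?t 0\<close> is \<open>(b ^ m - a ^ m) * (\<omega> ^ m - 1)\<close>;
      here \<open>0 < m\<close> gives strictness.\<close>
    have "b ^ m < a ^ m" "1 < \<omega> ^ m"
      using assms by (auto intro!: power_strict_mono)
    then have "?t 0 < 0"
      by (simp add: mult_neg_pos)
    then show "\<exists>j\<in>{..m}. ?t j < 0"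
      by blast
  qed simp
  finally show ?thesis by simp
qed

lemma lmbd_tau1_less_1:
  assumes "2 \<le> n" "1/2 < \<psi>" "\<psi> < 1" "1 < \<omega>"
  shows "lmbd_tau1 n \<psi> \<omega> < 1"
proof -
  obtain m where n: "n = Suc m" and m: "0 < m"
    using assms(1) by (cases n) auto
  let ?b = "\<lambda>j. real (m choose j) * \<psi> ^ j * (1 - \<psi>) ^ (m - j)"
  \<comment> \<open>For j \<le> m, \<open>?u j\<close> is g (j + 1) and \<open>?v j\<close> is g
    j.\<close>
  let ?u = "\<lambda>j. \<omega> ^ ((m - j) * Suc j)"
  let ?v = "\<lambda>j. \<omega> ^ (Suc (m - j) * j)"
  have "lmbd_K n \<psi> \<omega> = (\<Sum>j\<le>m. ?b j * (\<psi> * ?u j + (1 - \<psi>) * ?v j))"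
    unfolding lmbd_K_def n atLeast0AtMost sum_binomial_Suc
    by (intro sum.cong) (auto simp: Suc_diff_le)
  moreover have "lmbd_K_pred n \<psi> \<omega> = (\<Sum>j\<le>m. ?b j * ?u j)"
    by (simp add: lmbd_K_pred_def n atLeast0AtMost)
  \<comment> \<open>Termwise, u - (\<psi> u + (1 - \<psi>) v) = (1 - \<psi>) (u - v).\<close>
  ultimately have "lmbd_K_pred n \<psi> \<omega> - lmbd_K n \<psi> \<omega>
      = (1 - \<psi>) * (\<Sum>j\<le>m. ?b j * (?u j - ?v j))"
    by (simp only: sum_subtractf[symmetric] sum_distrib_left)
      (intro sum.cong refl, simp only: algebra_simps)
  also have "\<dots> < 0"
    using assms m by (intro mult_pos_neg sum_binomial_increment_neg) auto
  finally show ?thesis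
    using lmbd_K_pos[of \<psi> \<omega> n] assms by (simp add: lmbd_tau1_def)
qed

theorem theorem2:
  fixes n :: nat and \<psi> \<omega> \<pi> :: real
    and M :: "'a measure" and Y :: "'a \<Rightarrow> nat"
  assumes "1 \<le> n" and "\<psi> \<in> {0..1}" and "\<omega> > 0"
    and "prob_space M"
    and "Y \<in> measurable M (count_space UNIV)"
    and "distr M (count_space UNIV) Y = measure_pmf (lmbd_pmf n \<psi> \<omega>)"
    and "\<pi> = \<psi> * lmbd_tau1 n \<psi> \<omega>"
    and "\<psi> \<ge> 1/2"
    and "n \<noteq> 1" and "\<psi> \<noteq> 1/2" and "\<psi> \<noteq> 1"
  shows "\<omega> > 1 \<longrightarrow> \<psi> > \<pi>"
proof
  assume "\<omega> > 1"
  \<comment> \<open>The excluded cases are those where \<open>lmbd_success_prob_degenerate\<close>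
    gives equality; without them 2 \<le> n and 1/2 < \<psi> < 1.\<close>
  then have "lmbd_tau1 n \<psi> \<omega> < 1"
    using assms by (intro lmbd_tau1_less_1) auto
  then show "\<psi> > \<pi>"
    using assms by simp
qed

end
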